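(* Let $L$ be an NP-hard classical problem and let $R$ be a parameterized problem. Suppose that there is a linear OR composition from $L$ to $R$, and that $R$ admits a polynomial-size Turing kernel with $O(n^{1-\varepsilon})$ queries for some $\varepsilon>0$ (where $n$ is the input size). Then $L$ admits an oracle OR distillation into $R$.
   Context: A classical problem is a subset of $\{0,1\}^*$; a parameterized problem is a subset of $\{0,1\}^*\times\mathbb{N}$, and for an instance $(y,p)$, $|(y,p)|:=|y|+p+c_0$ for a fixed constant $c_0$. A linear OR composition from $L$ to $R$ is an algorithm that takes $t$ instances $x_1,\dots,x_t$ of $L$ and computes in time $\mathrm{poly}(\sum_i|x_i|)$ an instance $(y,p)$ of $R$ with (i) $|(y,p)|=t\cdot\mathrm{poly}(\log t)\cdot\mathrm{poly}(\max_i|x_i|)$, (ii) $p=\mathrm{poly}(\max_i|x_i|+\log t)$, (iii) $(y,p)\in R$ iff $x_i\in L$ for some $i$. A Turing kernel for $R$ is a polynomial-time algorithm with oracle access to $R$ deciding $(x,p)\in R$ using only queries $(y,p')$ with $|y|+p'\le f(p)$ for computable $f$; polynomial-size if $f$ is a polynomial. An oracle OR distillation of $L$ into $R$ is an algorithm $\mathcal{A}$ with oracle access to $R$ such that for some $\varepsilon>0$, given any instances $x_1,\dots,x_t$ of $L$, $\mathcal{A}$ uses oracle queries $(y_1,p_1),\dots,(y_s,p_s)$ of total size $\sum_{i=1}^s|(y_i,p_i)|\le t^{1-\varepsilon}\,\mathrm{poly}(\max_i|x_i|)$ and returns "Yes" iff $x_i\in L$ for some $i$. *)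

theory Defs
  imports
    Complex_Main
    "HOL-Computational_Algebra.Polynomial"
    "HOL-Library.Landau_Symbols"
begin

section \<open>Problems and instances\<close>

type_synonym bits = "bool list"
type_synonym classical_problem = "bits set"
type_synonym inst = "bits \<times> nat"
type_synonym param_problem = "inst set"

definition psize :: "nat \<Rightarrow> inst \<Rightarrow> nat" where
  "psize c0 = (\<lambda>(y, p). length y + p + c0)"

section \<open>Multi-tape (oracle) Turing machines\<close>

text \<open>
  The tape alphabet is fixed. This costs no generality: a larger alphabet can be
  block-coded with constant-factor overhead.
\<close>

datatype sym = Blank | Zero | One | Hash

datatype dir = MoveL | Stay | MoveR

text \<open>
  A tape, infinite in both directions, is a pair \<open>(l, r)\<close>: \<open>r\<close> is the content from the
  scanned cell rightwards, \<open>l\<close> the content left of it, nearest cell first; all cells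
  beyond the two lists are blank.
\<close>

type_synonym tape = "sym list \<times> sym list"

definition read_tape :: "tape \<Rightarrow> sym" where
  "read_tape = (\<lambda>(l, r). case r of [] \<Rightarrow> Blank | s # _ \<Rightarrow> s)"

definition write_tape :: "sym \<Rightarrow> tape \<Rightarrow> tape" where
  "write_tape s = (\<lambda>(l, r). (l, s # tl r))"

definition move_tape :: "dir \<Rightarrow> tape \<Rightarrow> tape" where
  "move_tape d tp = (case d of
      MoveL \<Rightarrow> (case fst tp of [] \<Rightarrow> ([], Blank # snd tp) | s # l \<Rightarrow> (l, s # snd tp))
    | Stay \<Rightarrow> tp
    | MoveR \<Rightarrow> (read_tape tp # fst tp, tl (snd tp)))"

definition word_at_head :: "tape \<Rightarrow> sym list" where
  "word_at_head tp = takeWhile (\<lambda>s. s \<noteq> Blank) (snd tp)"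

text \<open>
  States are the numbers below \<open>num_states\<close>, and computations start in state 0. The input is
  on the first tape. The last tape carries both the output and the oracle queries: in either
  case the word is read from the head position to the first blank.
  The field \<open>oracle_states\<close> is \<open>Some (query, yes, no)\<close> for an oracle machine and \<open>None\<close> for
  an ordinary one.
\<close>

record machine =
  num_tapes :: nat
  num_states :: nat
  trans :: "nat \<Rightarrow> sym list \<Rightarrow> nat \<times> (sym \<times> dir) list"
  accept_state :: nat
  reject_state :: nat
  oracle_states :: "(nat \<times> nat \<times> nat) option"

definition wf_machine :: "machine \<Rightarrow> bool" where
  "wf_machine M \<longleftrightarrow>
     0 < num_tapes M \<and> 0 < num_states M \<and>
     accept_state M < num_states M \<and> reject_state M < num_states M \<and>
     accept_state M \<noteq> reject_state M \<and>
     (\<forall>q < num_states M. \<forall>ss. length ss = num_tapes M \<longrightarrow>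
        fst (trans M q ss) < num_states M \<and> length (snd (trans M q ss)) = num_tapes M) \<and>
     (\<forall>qq qy qn. oracle_states M = Some (qq, qy, qn) \<longrightarrow>
        qq < num_states M \<and> qy < num_states M \<and> qn < num_states M \<and>
        qq \<noteq> accept_state M \<and> qq \<noteq> reject_state M)"

definition plain_machine :: "machine \<Rightarrow> bool" where
  "plain_machine M \<longleftrightarrow> wf_machine M \<and> oracle_states M = None"

type_synonym config = "nat \<times> tape list"

definition init_config :: "machine \<Rightarrow> sym list \<Rightarrow> config" where
  "init_config M w = (0, ([], w) # replicate (num_tapes M - 1) ([], []))"

definition halted :: "machine \<Rightarrow> config \<Rightarrow> bool" where
  "halted M c \<longleftrightarrow> fst c = accept_state M \<or> fst c = reject_state M"

definition querying :: "machine \<Rightarrow> config \<Rightarrow> bool" where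
  "querying M c \<longleftrightarrow> (\<exists>qy qn. oracle_states M = Some (fst c, qy, qn))"

definition last_word :: "config \<Rightarrow> sym list" where
  "last_word c = word_at_head (last (snd c))"

text \<open>The oracle is a set of words; a query costs one step and leaves the tapes unchanged.\<close>

definition step :: "sym list set \<Rightarrow> machine \<Rightarrow> config \<Rightarrow> config" where
  "step orc M c =
    (if halted M c then c
     else if querying M c then
       (case the (oracle_states M) of
          (_, qy, qn) \<Rightarrow> (if last_word c \<in> orc then qy else qn, snd c))
     else
       (case trans M (fst c) (map read_tape (snd c)) of
          (q', acts) \<Rightarrow>
            (q', map2 (\<lambda>(s, d) tp. move_tape d (write_tape s tp)) acts (snd c))))"

definition config_at :: "sym list set \<Rightarrow> machine \<Rightarrow> sym list \<Rightarrow> nat \<Rightarrow> config" where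
  "config_at orc M w n = (step orc M ^^ n) (init_config M w)"

definition halts :: "sym list set \<Rightarrow> machine \<Rightarrow> sym list \<Rightarrow> bool" where
  "halts orc M w \<longleftrightarrow> (\<exists>n. halted M (config_at orc M w n))"

text \<open>The next four notions are meaningful only when the machine halts.\<close>

definition runtime :: "sym list set \<Rightarrow> machine \<Rightarrow> sym list \<Rightarrow> nat" where
  "runtime orc M w = (LEAST n. halted M (config_at orc M w n))"

definition accepts :: "sym list set \<Rightarrow> machine \<Rightarrow> sym list \<Rightarrow> bool" where
  "accepts orc M w \<longleftrightarrow> fst (config_at orc M w (runtime orc M w)) = accept_state M"

definition output_word :: "sym list set \<Rightarrow> machine \<Rightarrow> sym list \<Rightarrow> sym list" where
  "output_word orc M w = last_word (config_at orc M w (runtime orc M w))"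

definition queries :: "sym list set \<Rightarrow> machine \<Rightarrow> sym list \<Rightarrow> sym list list" where
  "queries orc M w =
     map last_word (filter (querying M) (map (config_at orc M w) [0..<runtime orc M w]))"

definition halts_within :: "sym list set \<Rightarrow> machine \<Rightarrow> sym list \<Rightarrow> nat \<Rightarrow> bool" where
  "halts_within orc M w T \<longleftrightarrow> halts orc M w \<and> runtime orc M w \<le> T"

section \<open>Encodings\<close>

definition enc_bits :: "bits \<Rightarrow> sym list" where
  "enc_bits x = map (\<lambda>b. if b then One else Zero) x"

text \<open>The parameter is written in unary, in accordance with its contribution to \<open>psize\<close>.\<close>

definition enc_inst :: "inst \<Rightarrow> sym list" where
  "enc_inst = (\<lambda>(y, p). enc_bits y @ Hash # replicate p One)"

definition enc_pair :: "bits \<Rightarrow> bits \<Rightarrow> sym list" where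
  "enc_pair x w = enc_bits x @ Hash # enc_bits w"

definition enc_list :: "bits list \<Rightarrow> sym list" where
  "enc_list xs = concat (map (\<lambda>x. enc_bits x @ [Hash]) xs)"

definition oracle_of :: "param_problem \<Rightarrow> sym list set" where
  "oracle_of R = enc_inst ` R"

lemma inj_enc_inst: "inj enc_inst"
proof (rule injI, clarsimp simp: enc_inst_def)
  fix y p y' p'
  assume eq: "enc_bits y @ Hash # replicate p One = enc_bits y' @ Hash # replicate p' One"
  have nh: "Hash \<notin> set (enc_bits z)" for z
    by (auto simp: enc_bits_def)
  have tw: "takeWhile (\<lambda>s. s \<noteq> Hash) (enc_bits z @ Hash # r) = enc_bits z" for z r
    using nh[of z] by (subst takeWhile_append2) auto
  have e: "enc_bits y = enc_bits y'"
    using arg_cong[OF eq, of "takeWhile (\<lambda>s. s \<noteq> Hash)"] unfolding tw .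
  have "inj (\<lambda>b. if b then One else Zero)"
    by (auto simp: inj_def split: if_splits)
  then have "y = y'"
    using e unfolding enc_bits_def by (simp add: inj_map_eq_map)
  moreover have "p = p'"
    using arg_cong[OF eq, of length] e by simp
  ultimately show "y = y' \<and> p = p'" by simp
qed

section \<open>NP-hardness\<close>

definition in_NP :: "classical_problem \<Rightarrow> bool" where
  "in_NP A \<longleftrightarrow>
     (\<exists>V (r :: nat poly) (q :: nat poly). plain_machine V \<and>
        (\<forall>x w. halts_within {} V (enc_pair x w) (poly r (length x + length w))) \<and>
        (\<forall>x. x \<in> A \<longleftrightarrow>
           (\<exists>w. length w \<le> poly q (length x) \<and> accepts {} V (enc_pair x w))))"

definition poly_reducible :: "classical_problem \<Rightarrow> classical_problem \<Rightarrow> bool" where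
  "poly_reducible A B \<longleftrightarrow>
     (\<exists>M (r :: nat poly) f. plain_machine M \<and>
        (\<forall>x. halts_within {} M (enc_bits x) (poly r (length x)) \<and>
             output_word {} M (enc_bits x) = enc_bits (f x) \<and>
             (x \<in> A \<longleftrightarrow> f x \<in> B)))"

definition NP_hard :: "classical_problem \<Rightarrow> bool" where
  "NP_hard L \<longleftrightarrow> (\<forall>A. in_NP A \<longrightarrow> poly_reducible A L)"

section \<open>Compositions, Turing kernels, distillations\<close>

definition max_len :: "bits list \<Rightarrow> nat" where
  "max_len xs = Max (length ` set xs)"

text \<open>
  Running time is measured in the length of the encoded tuple, which is the total length of
  the instances plus their number; the number only matters when there are empty strings.
  An equation such as \<open>p = poly(n)\<close> in the literature is an upper bound.
\<close>

definition linear_OR_composition ::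
  "nat \<Rightarrow> classical_problem \<Rightarrow> param_problem \<Rightarrow> bool" where
  "linear_OR_composition c0 L R \<longleftrightarrow>
     (\<exists>M (r :: nat poly) (a :: real poly) (b :: real poly) (d :: real poly).
        plain_machine M \<and>
        (\<forall>xs. xs \<noteq> [] \<longrightarrow>
           halts_within {} M (enc_list xs) (poly r (length (enc_list xs))) \<and>
           (\<exists>y p. output_word {} M (enc_list xs) = enc_inst (y, p) \<and>
              real (psize c0 (y, p))
                \<le> real (length xs) * poly a (log 2 (real (length xs)))
                    * poly b (real (max_len xs)) \<and>
              real p \<le> poly d (real (max_len xs) + log 2 (real (length xs))) \<and>
              ((y, p) \<in> R \<longleftrightarrow> (\<exists>x \<in> set xs. x \<in> L)))))"

definition turing_kernel ::
  "nat \<Rightarrow> machine \<Rightarrow> param_problem \<Rightarrow> (nat \<Rightarrow> nat) \<Rightarrow> bool" where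
  "turing_kernel c0 M R f \<longleftrightarrow> wf_machine M \<and>
     (\<exists>r :: nat poly. \<forall>x p.
        halts_within (oracle_of R) M (enc_inst (x, p)) (poly r (psize c0 (x, p)))) \<and>
     (\<forall>x p. accepts (oracle_of R) M (enc_inst (x, p)) \<longleftrightarrow> (x, p) \<in> R) \<and>
     (\<forall>x p. \<forall>w \<in> set (queries (oracle_of R) M (enc_inst (x, p))).
        \<exists>y p'. w = enc_inst (y, p') \<and> length y + p' \<le> f p)"

text \<open>Polynomials are computable, so no separate computability condition on \<open>f\<close> is needed.\<close>

definition poly_turing_kernel :: "nat \<Rightarrow> machine \<Rightarrow> param_problem \<Rightarrow> bool" where
  "poly_turing_kernel c0 M R \<longleftrightarrow> (\<exists>f :: nat poly. turing_kernel c0 M R (poly f))"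

definition query_bound ::
  "nat \<Rightarrow> machine \<Rightarrow> param_problem \<Rightarrow> (nat \<Rightarrow> nat) \<Rightarrow> bool" where
  "query_bound c0 M R g \<longleftrightarrow>
     (\<forall>x p. length (queries (oracle_of R) M (enc_inst (x, p))) \<le> g (psize c0 (x, p)))"

text \<open>
  As usual for distillations, the algorithm is required to run in polynomial time; without
  that clause the notion would be weaker, and without content for decidable \<open>L\<close>.
\<close>

definition oracle_OR_distillation ::
  "nat \<Rightarrow> machine \<Rightarrow> classical_problem \<Rightarrow> param_problem \<Rightarrow> bool" where
  "oracle_OR_distillation c0 M L R \<longleftrightarrow> wf_machine M \<and>
     (\<exists>r :: nat poly. \<forall>xs. xs \<noteq> [] \<longrightarrow>
        halts_within (oracle_of R) M (enc_list xs) (poly r (length (enc_list xs)))) \<and>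
     (\<exists>\<epsilon> > 0. \<exists>b :: real poly. \<forall>xs. xs \<noteq> [] \<longrightarrow>
        (\<exists>ys. queries (oracle_of R) M (enc_list xs) = map enc_inst ys \<and>
           real (\<Sum>y\<leftarrow>ys. psize c0 y)
             \<le> real (length xs) powr (1 - \<epsilon>) * poly b (real (max_len xs)))) \<and>
     (\<forall>xs. xs \<noteq> [] \<longrightarrow>
        (accepts (oracle_of R) M (enc_list xs) \<longleftrightarrow> (\<exists>x \<in> set xs. x \<in> L)))"

end

theory Submission imports Defs begin

text \<open>
  The distillation runs the linear OR composition and then the Turing kernel on its output
  \<open>(y, p)\<close>. Writing \<open>m\<close> for the maximal instance length, \<open>(y, p)\<close> has size
  \<open>t * poly (log t) * poly m\<close>, so the kernel asks at most \<open>t powr (1 - \<epsilon>) * poly (log t) * poly m\<close>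
  queries, each of size at most \<open>poly p = poly (m + log t)\<close>. The factors polynomial in \<open>log t\<close>
  are absorbed by \<open>t powr (\<epsilon> / 2)\<close>. The composition is needed only as a machine that computes an
  instance of \<open>R\<close>; that machine asks no queries, so all queries are those of the kernel.
\<close>

section \<open>Tapes up to trailing blanks\<close>

text \<open>Linearity in t decides the exponent: a size t * A raised to the power 1 - \<epsilon> is
  t powr (1 - \<epsilon>) times A powr (1 - \<epsilon>), and part of the saved factor t powr
  \<epsilon> is left after the logarithms are paid for. The parameter sees t only through its
  logarithm, so the size of a single query costs no power of t. Most of the work goes into one
  machine that runs both algorithms and whose query list is exactly that of the kernel. The obstacle
  there is representation: every transition writes on every tape, so even a resting tape acquires
  explicit blanks, and different lists describe the same tape. Simulations are therefore stated up
  to trailing blanks, a relation respected by reading, writing, moving and the word at the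
  head.\<close>

definition blank_eq :: "sym list \<Rightarrow> sym list \<Rightarrow> bool" where
  "blank_eq l l' \<longleftrightarrow> (\<forall>i. nth_default Blank l i = nth_default Blank l' i)"

definition tape_eq :: "tape \<Rightarrow> tape \<Rightarrow> bool" where
  "tape_eq tp tp' \<longleftrightarrow> blank_eq (fst tp) (fst tp') \<and> blank_eq (snd tp) (snd tp')"

lemma blank_eq_refl [simp]: "blank_eq l l"
  by (simp add: blank_eq_def)

lemma blank_eq_trans: "blank_eq l l' \<Longrightarrow> blank_eq l' l'' \<Longrightarrow> blank_eq l l''"
  by (simp add: blank_eq_def)

lemma blank_eq_Cons_iff [simp]: "blank_eq (s # l) (s' # l') \<longleftrightarrow> s = s' \<and> blank_eq l l'"
  unfolding blank_eq_def by (auto simp: nth_default_Cons split: nat.splits)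

lemma blank_eq_Cons_Nil_iff [simp]: "blank_eq (s # l) [] \<longleftrightarrow> s = Blank \<and> blank_eq l []"
  unfolding blank_eq_def by (auto simp: nth_default_Cons split: nat.splits)

lemma blank_eq_Nil_Cons_iff [simp]: "blank_eq [] (s # l) \<longleftrightarrow> s = Blank \<and> blank_eq [] l"
  unfolding blank_eq_def by (auto simp: nth_default_Cons split: nat.splits)

lemma tape_eq_refl [simp]: "tape_eq tp tp"
  by (simp add: tape_eq_def)

lemma tape_eq_trans: "tape_eq tp tp' \<Longrightarrow> tape_eq tp' tp'' \<Longrightarrow> tape_eq tp tp''"
  by (auto simp: tape_eq_def intro: blank_eq_trans)

lemma read_tape_eq: "tape_eq tp tp' \<Longrightarrow> read_tape tp = read_tape tp'"
  by (cases tp; cases tp') (auto simp: tape_eq_def read_tape_def split: list.splits)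

lemma write_tape_eq: "tape_eq tp tp' \<Longrightarrow> tape_eq (write_tape s tp) (write_tape s tp')"
proof (cases tp; cases tp')
  fix l r l' r' assume "tape_eq tp tp'" "tp = (l, r)" "tp' = (l', r')"
  then show ?thesis
    by (cases r; cases r') (auto simp: tape_eq_def write_tape_def)
qed

lemma move_tape_eq:
  assumes "tape_eq tp tp'"
  shows "tape_eq (move_tape d tp) (move_tape d tp')"
proof -
  obtain l r l' r' where [simp]: "tp = (l, r)" "tp' = (l', r')"
    by (cases tp; cases tp')
  show ?thesis
    using assms read_tape_eq[OF assms]
    by (cases d; cases r; cases r'; cases l; cases l') (auto simp: tape_eq_def move_tape_def)
qed

text \<open>Plain equality fails on an empty right half: writing back the blank just read creates an
  explicit \<open>Blank\<close>.\<close>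

lemma write_read_tape_eq: "tape_eq (write_tape (read_tape tp) tp) tp"
  by (cases tp) (auto simp: tape_eq_def write_tape_def read_tape_def split: list.splits)

text \<open>An explicit blank and the end of the list cut the word at the same place.\<close>

lemma takeWhile_blank_eq:
  "blank_eq r r' \<Longrightarrow> takeWhile (\<lambda>s. s \<noteq> Blank) r = takeWhile (\<lambda>s. s \<noteq> Blank) r'"
  by (induction r r' rule: list_induct2') auto

lemma word_at_head_eq: "tape_eq tp tp' \<Longrightarrow> word_at_head tp = word_at_head tp'"
  by (simp add: tape_eq_def word_at_head_def takeWhile_blank_eq)

lemma list_tape_eq_trans:
  "list_all2 tape_eq ts ts' \<Longrightarrow> list_all2 tape_eq ts' ts'' \<Longrightarrow> list_all2 tape_eq ts ts''"
  by (rule list_all2_trans[of tape_eq tape_eq tape_eq]) (auto intro: tape_eq_trans)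

text \<open>States and leading tapes are arbitrary, since only the last tape is read. Thus query
  words survive when the tapes of another machine are put in front.\<close>

lemma last_word_tape_eq:
  assumes "list_all2 tape_eq us us'" "us \<noteq> []"
  shows "last_word (q, ts @ us) = last_word (q', us')"
proof -
  have "length us = length us'"
    using assms(1) by (rule list_all2_lengthD)
  moreover from this have "us' \<noteq> []" using assms(2) by auto
  ultimately have "tape_eq (last us) (last us')"
    using assms by (simp add: last_conv_nth list_all2_conv_all_nth)
  then show ?thesis
    using assms(2) by (simp add: last_word_def word_at_head_eq)
qed

lemma tape_eq_map_read:
  "list_all2 tape_eq ts ts' \<Longrightarrow> map read_tape ts = map read_tape ts'"
  by (induction rule: list_all2_induct) (auto intro: read_tape_eq)

definition apply_acts :: "(sym \<times> dir) list \<Rightarrow> tape list \<Rightarrow> tape list" where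
  "apply_acts acts ts = map2 (\<lambda>(s, d) tp. move_tape d (write_tape s tp)) acts ts"

lemma apply_acts_Nil [simp]: "apply_acts [] [] = []"
  by (simp add: apply_acts_def)

lemma apply_acts_Cons [simp]:
  "apply_acts ((s, d) # acts) (tp # ts) = move_tape d (write_tape s tp) # apply_acts acts ts"
  by (simp add: apply_acts_def)

lemma length_apply_acts [simp]: "length (apply_acts acts ts) = min (length acts) (length ts)"
  by (simp add: apply_acts_def)

lemma apply_acts_append:
  "length acts = length ts \<Longrightarrow>
     apply_acts (acts @ acts') (ts @ ts') = apply_acts acts ts @ apply_acts acts' ts'"
  by (simp add: apply_acts_def)

lemma apply_acts_eq:
  assumes "list_all2 tape_eq ts ts'"
  shows "list_all2 tape_eq (apply_acts acts ts) (apply_acts acts ts')"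
  using assms
proof (induction arbitrary: acts rule: list_all2_induct)
  case Nil
  then show ?case by (simp add: apply_acts_def)
next
  case (Cons t ts t' ts')
  then show ?case
    by (cases acts)
      (auto simp: apply_acts_def intro: move_tape_eq write_tape_eq)
qed

text \<open>A transition must act on every tape; applied to the scanned symbols, this is the idle
  action.\<close>

definition keep :: "sym list \<Rightarrow> (sym \<times> dir) list" where
  "keep = map (\<lambda>s. (s, Stay))"

lemma length_keep [simp]: "length (keep ss) = length ss"
  by (simp add: keep_def)

lemma apply_keep: "list_all2 tape_eq (apply_acts (keep (map read_tape ts)) ts) ts"
  by (induction ts) (auto simp: keep_def move_tape_def write_read_tape_eq)

lemma apply_keep_trans:
  "list_all2 tape_eq us us0 \<Longrightarrow>
     list_all2 tape_eq (apply_acts (keep (map read_tape us)) us) us0"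
  using apply_keep list_tape_eq_trans by blast

section \<open>Single steps and machines without an oracle\<close>

lemma step_regular:
  assumes "\<not> halted M c" "\<not> querying M c" "trans M (fst c) (map read_tape (snd c)) = (q', acts)"
  shows "step orc M c = (q', apply_acts acts (snd c))"
  using assms by (simp add: step_def apply_acts_def)

lemma config_at_0 [simp]: "config_at orc M w 0 = init_config M w"
  by (simp add: config_at_def)

lemma config_at_Suc [simp]: "config_at orc M w (Suc n) = step orc M (config_at orc M w n)"
  by (simp add: config_at_def)

definition wf_config :: "machine \<Rightarrow> config \<Rightarrow> bool" where
  "wf_config M c \<longleftrightarrow> fst c < num_states M \<and> length (snd c) = num_tapes M"

lemma wf_config_step:
  assumes "wf_machine M" "wf_config M c"
  shows "wf_config M (step orc M c)"
proof -
  obtain q ts where c: "c = (q, ts)" by fastforce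
  obtain q' acts where tr: "trans M q (map read_tape ts) = (q', acts)" by fastforce
  have q: "q < num_states M" "length ts = num_tapes M"
    using assms c by (auto simp: wf_config_def)
  have tr': "q' < num_states M \<and> length acts = num_tapes M"
    using assms(1) q tr unfolding wf_machine_def by (metis fst_conv length_map snd_conv)
  show ?thesis
  proof (cases "halted M c \<or> querying M c")
    case True
    then show ?thesis
      using assms q by (auto simp: step_def wf_config_def querying_def wf_machine_def c
          split: prod.splits)
  next
    case False
    then show ?thesis
      using step_regular[of M c q' acts orc] tr tr' q by (auto simp: c wf_config_def)
  qed
qed

lemma wf_config_at: "wf_machine M \<Longrightarrow> wf_config M (config_at orc M w n)"
proof (induction n)
  case 0
  then show ?case by (auto simp: wf_config_def init_config_def wf_machine_def)
next
  case (Suc n)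
  then show ?case by (simp add: wf_config_step)
qed

lemma not_querying_plain: "plain_machine M \<Longrightarrow> \<not> querying M c"
  by (simp add: plain_machine_def querying_def)

lemma halted_runtime:
  "halts orc M w \<Longrightarrow> halted M (config_at orc M w (runtime orc M w))"
  unfolding halts_def runtime_def by (rule LeastI_ex)

lemma not_halted_before_runtime:
  "n < runtime orc M w \<Longrightarrow> \<not> halted M (config_at orc M w n)"
  unfolding runtime_def by (rule not_less_Least)

text \<open>Only the right half is measured, because words are read from the head rightwards. A move
  to the left lengthens it by one; \<open>0 < B\<close> covers a write on an empty half.\<close>

lemma length_tape_step:
  assumes "\<forall>tp \<in> set (snd c). length (snd tp) \<le> B" "0 < B"
  shows "\<forall>tp \<in> set (snd (step orc M c)). length (snd tp) \<le> Suc B"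
proof -
  have one: "length (snd (move_tape d (write_tape s tp))) \<le> Suc B"
    if "length (snd tp) \<le> B" for d s tp
    using that assms(2)
    by (cases tp; cases d) (auto simp: move_tape_def write_tape_def split: list.splits)
  show ?thesis
  proof (cases "halted M c \<or> querying M c")
    case True
    then have "snd (step orc M c) = snd c"
      by (auto simp: step_def split: prod.split)
    then show ?thesis
      using assms(1) by (auto intro: le_SucI)
  next
    case False
    obtain q' acts where tr: "trans M (fst c) (map read_tape (snd c)) = (q', acts)"
      by fastforce
    have "snd (step orc M c) = apply_acts acts (snd c)"
      using step_regular[OF _ _ tr, of orc] False by simp
    then show ?thesis
      using one assms(1) by (auto simp: apply_acts_def dest!: set_zip_rightD)
  qed
qed

lemma length_tape_config_at:
  "\<forall>tp \<in> set (snd (config_at orc M w n)). length (snd tp) \<le> length w + 1 + n"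
proof (induction n)
  case 0
  then show ?case by (auto simp: init_config_def)
next
  case (Suc n)
  then show ?case
    using length_tape_step[OF Suc.IH, of orc M] by simp
qed

text \<open>The bound on the right halves grows by one per step. This turns the polynomial running
  time of the composition into a polynomial bound on the instance handed to the kernel.\<close>

lemma length_output_word:
  assumes "wf_machine M"
  shows "length (output_word orc M w) \<le> length w + 1 + runtime orc M w"
proof -
  let ?c = "config_at orc M w (runtime orc M w)"
  have "snd ?c \<noteq> []"
    using wf_config_at[OF assms, of orc w "runtime orc M w"] assms
    by (auto simp: wf_config_def wf_machine_def)
  then have "length (snd (last (snd ?c))) \<le> length w + 1 + runtime orc M w"
    using length_tape_config_at[of orc M w "runtime orc M w"] by auto
  moreover have "length (output_word orc M w) \<le> length (snd (last (snd ?c)))"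
    by (simp add: output_word_def last_word_def word_at_head_def length_takeWhile_le)
  ultimately show ?thesis by simp
qed

section \<open>Sequential composition of machines\<close>

text \<open>
  The tapes of the two machines are disjoint. In a halting state of \<open>M1\<close> the output word is
  copied to the first tape of \<open>M2\<close>, and state \<open>num_states M1\<close> then rewinds that tape. The states
  of \<open>M2\<close> are shifted by \<open>num_states M1 + 1\<close>.
\<close>

definition seq_trans ::
  "machine \<Rightarrow> machine \<Rightarrow> nat \<Rightarrow> sym list \<Rightarrow> nat \<times> (sym \<times> dir) list" where
  "seq_trans M1 M2 q ss =
    (let k = num_tapes M1; n = num_states M1 in
     if q < n then
       if q = accept_state M1 \<or> q = reject_state M1 then
         let s = ss ! (k - 1) in
         if s = Blank then (n, keep (take k ss) @ (ss ! k, MoveL) # keep (drop (k + 1) ss))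
         else (q, keep (take (k - 1) ss) @ [(s, MoveR), (s, MoveR)] @ keep (drop (k + 1) ss))
       else (case trans M1 q (take k ss) of (q', acts) \<Rightarrow> (q', acts @ keep (drop k ss)))
     else if q = n then
       let s = ss ! k in
       if s = Blank then (n + 1, keep (take k ss) @ (s, MoveR) # keep (drop (k + 1) ss))
       else (n, keep (take k ss) @ (s, MoveL) # keep (drop (k + 1) ss))
     else (case trans M2 (q - (n + 1)) (drop k ss) of
       (q', acts) \<Rightarrow> (n + 1 + q', keep (take k ss) @ acts)))"

text \<open>The tapes of \<open>M2\<close> come last, so its query tape is also that of the whole
  machine; the oracle states are those of \<open>M2\<close> only, shifted.\<close>

definition seq_machine :: "machine \<Rightarrow> machine \<Rightarrow> machine" where
  "seq_machine M1 M2 =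
    \<lparr>num_tapes = num_tapes M1 + num_tapes M2,
     num_states = num_states M1 + 1 + num_states M2,
     trans = seq_trans M1 M2,
     accept_state = num_states M1 + 1 + accept_state M2,
     reject_state = num_states M1 + 1 + reject_state M2,
     oracle_states = map_option
       (\<lambda>(qq, qy, qn). (num_states M1 + 1 + qq, num_states M1 + 1 + qy, num_states M1 + 1 + qn))
       (oracle_states M2)\<rparr>"

lemma seq_machine_simps [simp]:
  "num_tapes (seq_machine M1 M2) = num_tapes M1 + num_tapes M2"
  "num_states (seq_machine M1 M2) = num_states M1 + 1 + num_states M2"
  "trans (seq_machine M1 M2) = seq_trans M1 M2"
  "accept_state (seq_machine M1 M2) = num_states M1 + 1 + accept_state M2"
  "reject_state (seq_machine M1 M2) = num_states M1 + 1 + reject_state M2"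
  by (simp_all add: seq_machine_def)

lemma halted_seq_iff:
  "halted (seq_machine M1 M2) (num_states M1 + 1 + q, ts @ us) \<longleftrightarrow> halted M2 (q, us')"
  by (simp add: halted_def)

lemma querying_seq_iff:
  "querying (seq_machine M1 M2) (num_states M1 + 1 + q, ts @ us) \<longleftrightarrow> querying M2 (q, us')"
  by (auto simp: querying_def seq_machine_def)

text \<open>The bound covers every state of \<open>M1\<close>, also its halting states, which here
  serve for copying, and the rewinding state.\<close>

lemma not_halted_seq: "fst c \<le> num_states M1 \<Longrightarrow> \<not> halted (seq_machine M1 M2) c"
  by (simp add: halted_def)

lemma not_querying_seq: "fst c \<le> num_states M1 \<Longrightarrow> \<not> querying (seq_machine M1 M2) c"
  by (auto simp: querying_def seq_machine_def)

lemma wf_seq_machine: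
  assumes "plain_machine M1" "wf_machine M2"
  shows "wf_machine (seq_machine M1 M2)"
proof -
  let ?C = "seq_machine M1 M2"
  have w1: "wf_machine M1" using assms(1) by (simp add: plain_machine_def)
  have k: "0 < num_tapes M1" "0 < num_tapes M2"
    using w1 assms(2) by (auto simp: wf_machine_def)
  have "fst (seq_trans M1 M2 q ss) < num_states ?C \<and>
        length (snd (seq_trans M1 M2 q ss)) = num_tapes ?C"
    if q: "q < num_states ?C" and ss: "length ss = num_tapes ?C" for q ss
  proof -
    have t1: "fst (trans M1 q (take (num_tapes M1) ss)) < num_states M1 \<and>
        length (snd (trans M1 q (take (num_tapes M1) ss))) = num_tapes M1" if "q < num_states M1"
      using w1 that ss unfolding wf_machine_def by simp
    consider "q < num_states M1" | "q = num_states M1" | "q > num_states M1" by linarith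
    then show ?thesis
    proof cases
      case 1
      then show ?thesis
        using t1 ss k by (auto simp: seq_trans_def Let_def split: prod.splits)
    next
      case 2
      then show ?thesis
        using ss k assms(2) by (simp add: seq_trans_def Let_def wf_machine_def)
    next
      case 3
      define q2 where "q2 = q - (num_states M1 + 1)"
      have "q2 < num_states M2" using q 3 by (simp add: q2_def)
      then have "fst (trans M2 q2 (drop (num_tapes M1) ss)) < num_states M2 \<and>
          length (snd (trans M2 q2 (drop (num_tapes M1) ss))) = num_tapes M2"
        using assms(2) ss unfolding wf_machine_def by simp
      then show ?thesis
        using 3 ss by (auto simp: seq_trans_def Let_def q2_def split: prod.splits)
    qed
  qed
  moreover have "\<forall>qq qy qn. oracle_states ?C = Some (qq, qy, qn) \<longrightarrow>
        qq < num_states ?C \<and> qy < num_states ?C \<and> qn < num_states ?C \<and>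
        qq \<noteq> accept_state ?C \<and> qq \<noteq> reject_state ?C"
    using assms(2) unfolding wf_machine_def by (auto simp: seq_machine_def)
  moreover have "accept_state ?C < num_states ?C \<and> reject_state ?C < num_states ?C \<and>
      accept_state ?C \<noteq> reject_state ?C"
    using assms(2) by (auto simp: wf_machine_def)
  ultimately show ?thesis
    unfolding wf_machine_def using k by auto
qed

locale seq =
  fixes M1 M2 :: machine and orc :: "sym list set"
  assumes plain1: "plain_machine M1" and wf2: "wf_machine M2"
begin

abbreviation "C \<equiv> seq_machine M1 M2"

lemma wf1: "wf_machine M1"
  using plain1 by (simp add: plain_machine_def)

section \<open>Simulation of the first machine\<close>

lemma step_early:
  assumes "fst c \<le> num_states M1" "seq_trans M1 M2 (fst c) (map read_tape (snd c)) = (q', acts)"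
  shows "step orc C c = (q', apply_acts acts (snd c))"
  using assms by (intro step_regular) (auto simp: not_halted_seq not_querying_seq)

text \<open>A plain machine asks no queries, so its steps agree for \<open>orc\<close> and
  \<open>orc'\<close>. This lets a machine specified with the empty oracle run inside one that uses
  \<open>orc\<close>.\<close>

lemma simulate_first_step:
  assumes "wf_config M1 c" "\<not> halted M1 c" "step orc' M1 c = c'"
  shows "\<exists>us'. step orc C (fst c, snd c @ us) = (fst c', snd c' @ us') \<and>
               list_all2 tape_eq us' us"
proof -
  obtain q ts where c: "c = (q, ts)" by fastforce
  obtain q' acts where tr: "trans M1 q (map read_tape ts) = (q', acts)" by fastforce
  have q: "q < num_states M1" "length ts = num_tapes M1"
    using assms(1) c by (auto simp: wf_config_def)
  have "length acts = length ts"
    using wf1 q tr unfolding wf_machine_def by (metis length_map snd_conv)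
  moreover have "c' = (q', apply_acts acts ts)"
    using step_regular[of M1 c q' acts orc'] tr assms(2,3) not_querying_plain[OF plain1]
    by (simp add: c)
  moreover have "seq_trans M1 M2 q (map read_tape (ts @ us)) =
      (q', acts @ keep (map read_tape us))"
    using assms(2) q tr by (auto simp: seq_trans_def Let_def halted_def c)
  then have "step orc C (q, ts @ us) = (q', apply_acts (acts @ keep (map read_tape us)) (ts @ us))"
    using q by (subst step_early) auto
  ultimately show ?thesis
    using apply_keep[of us] by (auto simp: c apply_acts_append)
qed

text \<open>The range of \<open>n\<close> ends with the halting configuration of \<open>M1\<close>:
  from there on \<open>M1\<close> rests, while the composite begins to copy.\<close>

lemma simulate_first:
  assumes "n \<le> runtime orc' M1 w"
  shows "\<exists>us. config_at orc C w n =
      (fst (config_at orc' M1 w n), snd (config_at orc' M1 w n) @ us) \<and>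
      list_all2 tape_eq us (replicate (num_tapes M2) ([], []))"
  using assms
proof (induction n)
  case 0
  have "0 < num_tapes M1" using wf1 by (simp add: wf_machine_def)
  \<comment> \<open>The initial configuration treats the first tape apart; the natural subtraction
    is harmless since \<open>M1\<close> has a tape.\<close>
  then have "num_tapes M1 + num_tapes M2 - 1 = (num_tapes M1 - 1) + num_tapes M2" by simp
  then show ?case
    by (auto simp: init_config_def replicate_add list_all2_refl)
next
  case (Suc n)
  let ?c = "config_at orc' M1 w n"
  obtain us where us: "config_at orc C w n = (fst ?c, snd ?c @ us)"
      "list_all2 tape_eq us (replicate (num_tapes M2) ([], []))"
    using Suc by auto
  have "\<not> halted M1 ?c"
    using Suc.prems by (intro not_halted_before_runtime) simp
  then obtain us' where "step orc C (fst ?c, snd ?c @ us) =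
      (fst (step orc' M1 ?c), snd (step orc' M1 ?c) @ us')" "list_all2 tape_eq us' us"
    using simulate_first_step[OF wf_config_at[OF wf1]] by blast
  moreover from this(2) us(2) have "list_all2 tape_eq us' (replicate (num_tapes M2) ([], []))"
    by (rule list_tape_eq_trans)
  ultimately show ?case
    using us(1) by auto
qed

text \<open>The end point is exempt from the bound on states. In all earlier configurations the
  composite neither halts nor queries, so such a run leaves no trace in the query list.\<close>

definition early :: "nat \<Rightarrow> config \<Rightarrow> config \<Rightarrow> bool" where
  "early m c c' \<longleftrightarrow> (step orc C ^^ m) c = c' \<and>
     (\<forall>i<m. fst ((step orc C ^^ i) c) \<le> num_states M1)"

lemma early_Suc:
  assumes "fst c \<le> num_states M1" "early m (step orc C c) c'"
  shows "early (Suc m) c c'"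
  using assms by (auto simp: early_def less_Suc_eq_0_disj funpow_Suc_right simp del: funpow.simps)

lemma early_one: "fst c \<le> num_states M1 \<Longrightarrow> step orc C c = c' \<Longrightarrow> early 1 c c'"
  by (simp add: early_def)

lemma early_trans:
  assumes "early m c c'" "early m' c' c''"
  shows "early (m + m') c c''"
proof -
  have shift: "(step orc C ^^ (m + j)) c = (step orc C ^^ j) c'" for j
    using assms(1) by (simp add: early_def add.commute[of m] funpow_add)
  have "fst ((step orc C ^^ i) c) \<le> num_states M1" if "i < m + m'" for i
  proof (cases "i < m")
    case True
    then show ?thesis using assms(1) by (simp add: early_def)
  next
    case False
    then show ?thesis
      using shift[of "i - m"] that assms(2) by (auto simp: early_def)
  qed
  then show ?thesis
    using shift[of m'] assms(2) by (auto simp: early_def)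
qed

section \<open>Copying the output word and rewinding\<close>

lemma copy_step:
  assumes "q = accept_state M1 \<or> q = reject_state M1" "length ts + 1 = num_tapes M1"
    and "s \<noteq> Blank"
  shows "step orc C (q, ts @ (l, s # r) # u # us) =
    (q, apply_acts (keep (map read_tape ts)) ts @ (s # l, r) # move_tape MoveR (write_tape s u) #
        apply_acts (keep (map read_tape us)) us)"
proof -
  have q: "q < num_states M1" using assms(1) wf1 by (auto simp: wf_machine_def)
  have k: "num_tapes M1 = Suc (length ts)" using assms(2) by simp
  have "seq_trans M1 M2 q (map read_tape (ts @ (l, s # r) # u # us)) =
      (q, keep (map read_tape ts) @ (s, MoveR) # (s, MoveR) # keep (map read_tape us))"
    using q assms(1,3) by (auto simp: seq_trans_def Let_def nth_append read_tape_def k)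
  then show ?thesis
    using q by (subst step_early)
      (auto simp: apply_acts_append read_tape_def write_tape_def move_tape_def)
qed

text \<open>The move to the left takes the head back from the cell behind the copied word, whose
  blank would otherwise end the rewinding at once.\<close>

lemma copy_end_step:
  assumes "q = accept_state M1 \<or> q = reject_state M1" "length ts = num_tapes M1"
    and "read_tape (last ts) = Blank"
  shows "step orc C (q, ts @ u # us) =
    (num_states M1, apply_acts (keep (map read_tape ts)) ts @
       move_tape MoveL (write_tape (read_tape u) u) # apply_acts (keep (map read_tape us)) us)"
proof -
  have q: "q < num_states M1" using assms(1) wf1 by (auto simp: wf_machine_def)
  have "ts \<noteq> []" using assms(2) wf1 by (auto simp: wf_machine_def)
  then have "last (map read_tape ts) = Blank"
    using assms(3) by (simp add: last_map)
  then have k: "map read_tape ts ! (num_tapes M1 - 1) = Blank" "num_tapes M1 - 1 < num_tapes M1"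
    using assms(2) \<open>ts \<noteq> []\<close> wf1
    by (auto simp: last_conv_nth wf_machine_def simp del: last_map nth_map)
  then have "seq_trans M1 M2 q (map read_tape (ts @ u # us)) =
      (num_states M1, keep (map read_tape ts) @ (read_tape u, MoveL) # keep (map read_tape us))"
    using q assms(1,2) k by (auto simp: seq_trans_def Let_def nth_append)
  then show ?thesis
    using q by (subst step_early) (auto simp: apply_acts_append)
qed

lemma rewind_step:
  assumes "length ts = num_tapes M1" "read_tape u \<noteq> Blank"
  shows "step orc C (num_states M1, ts @ u # us) =
    (num_states M1, apply_acts (keep (map read_tape ts)) ts @
       move_tape MoveL (write_tape (read_tape u) u) # apply_acts (keep (map read_tape us)) us)"
proof -
  have "seq_trans M1 M2 (num_states M1) (map read_tape (ts @ u # us)) =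
      (num_states M1, keep (map read_tape ts) @ (read_tape u, MoveL) # keep (map read_tape us))"
    using assms by (simp add: seq_trans_def Let_def nth_append)
  then show ?thesis
    by (subst step_early) (auto simp: apply_acts_append)
qed

text \<open>Rewinding overshoots by one cell, to the blank in front of the word; the move to the
  right corrects this.\<close>

lemma rewind_end_step:
  assumes "length ts = num_tapes M1" "read_tape u = Blank"
  shows "step orc C (num_states M1, ts @ u # us) =
    (num_states M1 + 1, apply_acts (keep (map read_tape ts)) ts @
       move_tape MoveR (write_tape (read_tape u) u) # apply_acts (keep (map read_tape us)) us)"
proof -
  have "seq_trans M1 M2 (num_states M1) (map read_tape (ts @ u # us)) =
      (num_states M1 + 1, keep (map read_tape ts) @ (read_tape u, MoveR) # keep (map read_tape us))"
    using assms by (simp add: seq_trans_def Let_def nth_append)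
  then show ?thesis
    by (subst step_early) (auto simp: apply_acts_append)
qed

text \<open>\<open>v\<close> is the part already copied, in reverse, because moving right stores it
  in the left half; keeping it arbitrary makes the induction on \<open>r\<close> work. There is one
  step per symbol and one to notice the blank. \<open>MoveL\<close> stays unevaluated, since its
  effect depends on whether the left half is empty.\<close>

lemma copy_word:
  assumes "q = accept_state M1 \<or> q = reject_state M1"
    and "length ts + 1 = num_tapes M1"
    and "tape_eq u (v, [])" and "list_all2 tape_eq us us0"
  shows "\<exists>ts' u' us'. early (length (takeWhile (\<lambda>s. s \<noteq> Blank) r) + 1)
           (q, ts @ (l, r) # u # us) (num_states M1, ts' @ u' # us') \<and>
         length ts' = num_tapes M1 \<and> list_all2 tape_eq us' us0 \<and>
         tape_eq u' (move_tape MoveL (rev (takeWhile (\<lambda>s. s \<noteq> Blank) r) @ v, []))"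
proof -
  have q: "q \<le> num_states M1" using assms(1) wf1 by (auto simp: wf_machine_def)
  let ?goal = "\<lambda>r ts l u v us. \<exists>ts' u' us'. early (length (takeWhile (\<lambda>s. s \<noteq> Blank) r) + 1)
           (q, ts @ (l, r) # u # us) (num_states M1, ts' @ u' # us') \<and>
         length ts' = num_tapes M1 \<and> list_all2 tape_eq us' us0 \<and>
         tape_eq u' (move_tape MoveL (rev (takeWhile (\<lambda>s. s \<noteq> Blank) r) @ v, []))"
  \<comment> \<open>The word may end at an explicit \<open>Blank\<close> or at the end of the list;
    both cases of the induction finish here.\<close>
  have stop: "?goal r ts l u v us" if "takeWhile (\<lambda>s. s \<noteq> Blank) r = []" "length ts + 1 = num_tapes M1"
    "tape_eq u (v, [])" "list_all2 tape_eq us us0" for r ts l u v us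
  proof -
    let ?ts = "ts @ [(l, r)]"
    have "read_tape (last ?ts) = Blank"
      using that(1) by (auto simp: read_tape_def split: list.splits if_splits)
    from copy_end_step[OF assms(1) _ this, of u us] that(2)
    have "early 1 (q, ?ts @ u # us)
      (num_states M1, apply_acts (keep (map read_tape ?ts)) ?ts @
       move_tape MoveL (write_tape (read_tape u) u) # apply_acts (keep (map read_tape us)) us)"
      using q by (intro early_one) auto
    moreover have "tape_eq (move_tape MoveL (write_tape (read_tape u) u)) (move_tape MoveL (v, []))"
      using that(3) write_read_tape_eq tape_eq_trans move_tape_eq by blast
    ultimately show ?thesis
      using that apply_keep_trans[OF that(4)]
      by (intro exI[of _ "apply_acts (keep (map read_tape ?ts)) ?ts"]
          exI[of _ "move_tape MoveL (write_tape (read_tape u) u)"]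
          exI[of _ "apply_acts (keep (map read_tape us)) us"]) simp
  qed
  show "?goal r ts l u v us"
    using assms(2-4)
  proof (induction r arbitrary: ts l u v us)
    case Nil
    then show ?case using stop[of "[]"] by simp
  next
    case (Cons s r)
    show ?case
    proof (cases "s = Blank")
      case True
      then show ?thesis using stop[of "s # r"] Cons.prems by simp
    next
      case False
      let ?ts = "apply_acts (keep (map read_tape ts)) ts"
      let ?us = "apply_acts (keep (map read_tape us)) us"
      let ?u = "move_tape MoveR (write_tape s u)"
      have "tape_eq ?u (move_tape MoveR (write_tape s (v, [])))"
        using Cons.prems(2) by (intro move_tape_eq write_tape_eq)
      then have "tape_eq ?u (s # v, [])"
        by (simp add: move_tape_def write_tape_def read_tape_def)
      from Cons.IH[OF _ this apply_keep_trans[OF Cons.prems(3)], of ?ts "s # l"] Cons.prems(1)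
      obtain ts' u' us' where "early (length (takeWhile (\<lambda>s. s \<noteq> Blank) r) + 1)
           (q, ?ts @ (s # l, r) # ?u # ?us) (num_states M1, ts' @ u' # us')"
         "length ts' = num_tapes M1" "list_all2 tape_eq us' us0"
         "tape_eq u' (move_tape MoveL (rev (takeWhile (\<lambda>s. s \<noteq> Blank) r) @ s # v, []))"
        by auto
      then show ?thesis
        using early_Suc[of "(q, ts @ (l, s # r) # u # us)"] q False
          copy_step[OF assms(1) Cons.prems(1) False]
        by (intro exI[of _ ts'] exI[of _ u'] exI[of _ us']) auto
    qed
  qed
qed

text \<open>Symbols pass one by one from the left half \<open>v\<close> to the front of
  \<open>b\<close>. As \<open>v\<close> is free of blanks, the first blank met lies in front of the
  word.\<close>

lemma rewind:
  assumes "length ts = num_tapes M1" "Blank \<notin> set v"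
    and "tape_eq u (move_tape MoveL (v, b))" and "list_all2 tape_eq us us0"
  shows "\<exists>ts' u' us'. early (length v + 1)
           (num_states M1, ts @ u # us) (num_states M1 + 1, ts' @ u' # us') \<and>
         length ts' = num_tapes M1 \<and> list_all2 tape_eq us' us0 \<and> tape_eq u' ([], rev v @ b)"
  using assms
proof (induction v arbitrary: ts u us b)
  case Nil
  have u: "tape_eq u ([], Blank # b)" using Nil.prems(3) by (simp add: move_tape_def)
  have "read_tape u = Blank"
    using read_tape_eq[OF u] by (simp add: read_tape_def)
  from rewind_end_step[OF Nil.prems(1) this, of us]
  have "early 1 (num_states M1, ts @ u # us)
    (num_states M1 + 1, apply_acts (keep (map read_tape ts)) ts @
       move_tape MoveR (write_tape (read_tape u) u) # apply_acts (keep (map read_tape us)) us)"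
    by (intro early_one) auto
  moreover have "tape_eq (move_tape MoveR (write_tape (read_tape u) u))
      (move_tape MoveR ([], Blank # b))"
    using u write_read_tape_eq tape_eq_trans move_tape_eq by blast
  \<comment> \<open>Moving right leaves \<open>[Blank]\<close> as the left half of the comparison
    tape, which is \<open>[]\<close> up to trailing blanks.\<close>
  then have "tape_eq (move_tape MoveR (write_tape (read_tape u) u)) ([], b)"
    by (simp add: move_tape_def read_tape_def tape_eq_def)
  ultimately show ?case
    using Nil.prems(1) apply_keep_trans[OF Nil.prems(4)]
    by (intro exI[of _ "apply_acts (keep (map read_tape ts)) ts"]
        exI[of _ "move_tape MoveR (write_tape (read_tape u) u)"]
        exI[of _ "apply_acts (keep (map read_tape us)) us"]) simp
next
  case (Cons s v)
  have u: "tape_eq u (v, s # b)" using Cons.prems(3) by (simp add: move_tape_def)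
  have s: "read_tape u \<noteq> Blank"
    using read_tape_eq[OF u] Cons.prems(2) by (auto simp: read_tape_def)
  let ?ts = "apply_acts (keep (map read_tape ts)) ts"
  let ?us = "apply_acts (keep (map read_tape us)) us"
  let ?u = "move_tape MoveL (write_tape (read_tape u) u)"
  have "tape_eq ?u (move_tape MoveL (v, s # b))"
    using u write_read_tape_eq tape_eq_trans move_tape_eq by blast
  from Cons.IH[OF _ _ this apply_keep_trans[OF Cons.prems(4)], of ?ts] Cons.prems(1,2)
  obtain ts' u' us' where "early (length v + 1)
      (num_states M1, ?ts @ ?u # ?us) (num_states M1 + 1, ts' @ u' # us')"
    "length ts' = num_tapes M1" "list_all2 tape_eq us' us0" "tape_eq u' ([], rev v @ s # b)"
    by auto
  then show ?case
    using early_Suc[of "(num_states M1, ts @ u # us)"] rewind_step[OF Cons.prems(1) s]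
    by (intro exI[of _ ts'] exI[of _ u'] exI[of _ us']) auto
qed

text \<open>The leftover tapes of \<open>M1\<close> may hold anything, only their number matters.
  Both machines consult the same \<open>orc\<close> with the same last word, so query steps are
  matched one to one as well.\<close>

lemma simulate_second_step:
  assumes "wf_config M2 c" "length ts = num_tapes M1" "list_all2 tape_eq us (snd c)"
  shows "\<exists>ts' us'. step orc C (num_states M1 + 1 + fst c, ts @ us) =
      (num_states M1 + 1 + fst (step orc M2 c), ts' @ us') \<and>
      length ts' = num_tapes M1 \<and> list_all2 tape_eq us' (snd (step orc M2 c))"
proof -
  let ?n = "num_states M1 + 1"
  obtain q us2 where c: "c = (q, us2)" by fastforce
  let ?d = "(?n + q, ts @ us)"
  have q: "q < num_states M2" "length us2 = num_tapes M2"
    using assms(1) by (auto simp: wf_config_def c)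
  have len: "length us = length us2"
    using assms(3) by (auto simp: c dest: list_all2_lengthD)
  have h: "halted C ?d \<longleftrightarrow> halted M2 c" and qu: "querying C ?d \<longleftrightarrow> querying M2 c"
    unfolding c by (rule halted_seq_iff, rule querying_seq_iff)
  consider "halted M2 c" | "\<not> halted M2 c" "querying M2 c" | "\<not> halted M2 c" "\<not> querying M2 c"
    by blast
  then show ?thesis
  proof cases
    case 1
    then have "step orc C ?d = ?d" "step orc M2 c = c"
      using h by (simp_all add: step_def)
    then show ?thesis using assms by (auto simp: c)
  next
    case 2
    then obtain qy qn where o: "oracle_states M2 = Some (q, qy, qn)"
      by (auto simp: querying_def c)
    have "us \<noteq> []"
      using wf2 q len by (auto simp: wf_machine_def)
    then have "last_word ?d = last_word c"
      using assms(3) by (simp add: c last_word_tape_eq)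
    moreover have "oracle_states C = Some (?n + q, ?n + qy, ?n + qn)"
      by (simp add: seq_machine_def o)
    ultimately have "step orc C ?d = (if last_word c \<in> orc then ?n + qy else ?n + qn, ts @ us)"
      "step orc M2 c = (if last_word c \<in> orc then qy else qn, us2)"
      using 2 h qu by (simp_all add: step_def o c)
    then show ?thesis
      using assms(2,3) by (auto simp: c)
  next
    case 3
    obtain q' acts where tr: "trans M2 q (map read_tape us2) = (q', acts)" by fastforce
    have "map read_tape us = map read_tape us2"
      using assms(3) by (simp add: c tape_eq_map_read)
    then have "seq_trans M1 M2 (?n + q) (map read_tape (ts @ us)) =
        (?n + q', keep (map read_tape ts) @ acts)"
      using tr assms(2) by (simp add: seq_trans_def Let_def)
    then have "step orc C ?d = (?n + q', apply_acts (keep (map read_tape ts)) ts @ apply_acts acts us)"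
      using 3 h qu by (subst step_regular) (auto simp: apply_acts_append)
    moreover have "step orc M2 c = (q', apply_acts acts us2)"
      using 3 tr by (subst step_regular) (auto simp: c)
    ultimately show ?thesis
      using assms(2,3) apply_acts_eq[of us us2 acts]
      by (intro exI[of _ "apply_acts (keep (map read_tape ts)) ts"] exI[of _ "apply_acts acts us"])
        (simp add: c)
  qed
qed

text \<open>The count is the time of \<open>M1\<close> plus \<open>length v + 1\<close> steps each
  for copying and rewinding. The end point is state 0 of \<open>M2\<close> after the shift.\<close>

lemma transfer:
  assumes "halts {} M1 w"
  defines "v \<equiv> output_word {} M1 w"
  shows "\<exists>ts u us. early (runtime {} M1 w + (2 * length v + 2)) (init_config C w)
           (num_states M1 + 1, ts @ u # us) \<and>
         length ts = num_tapes M1 \<and> list_all2 tape_eq (u # us) (snd (init_config M2 v))"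
proof -
  let ?T = "runtime {} M1 w"
  let ?c = "config_at {} M1 w ?T"
  let ?blank = "replicate (num_tapes M2 - 1) ([], [])"
  obtain us where us: "config_at orc C w ?T = (fst ?c, snd ?c @ us)"
    "list_all2 tape_eq us (replicate (num_tapes M2) ([], []))"
    using simulate_first[OF order_refl] by blast
  have "num_tapes M2 = Suc (num_tapes M2 - 1)"
    using wf2 by (simp add: wf_machine_def)
  then obtain u us1 where us1: "us = u # us1" "tape_eq u ([], [])" "list_all2 tape_eq us1 ?blank"
    using us(2) by (metis list_all2_Cons2 replicate_Suc)
  have "fst (config_at orc C w i) \<le> num_states M1" if "i < ?T" for i
    using simulate_first[of i "{}" w] that wf_config_at[OF wf1, of "{}" w i]
    by (auto simp: wf_config_def)
  then have e1: "early ?T (init_config C w) (fst ?c, snd ?c @ us)"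
    using us(1) by (simp add: early_def config_at_def)
  have len: "length (snd ?c) = num_tapes M1"
    using wf_config_at[OF wf1] by (simp add: wf_config_def)
  then have "snd ?c \<noteq> []" using wf1 by (auto simp: wf_machine_def)
  then obtain ts l r where ts: "snd ?c = ts @ [(l, r)]"
    by (metis append_butlast_last_id surj_pair)
  have v: "v = takeWhile (\<lambda>s. s \<noteq> Blank) r"
    by (simp add: v_def output_word_def last_word_def word_at_head_def ts)
  have q: "fst ?c = accept_state M1 \<or> fst ?c = reject_state M1"
    using halted_runtime[OF assms(1)] by (simp add: halted_def)
  obtain ts' u' us' where
    e2: "early (length v + 1) (fst ?c, ts @ (l, r) # u # us1) (num_states M1, ts' @ u' # us')"
    and c2: "length ts' = num_tapes M1" "list_all2 tape_eq us' ?blank"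
      "tape_eq u' (move_tape MoveL (rev v, []))"
    using copy_word[OF q _ us1(2,3), of ts r l] len ts v by auto
  \<comment> \<open>The output word was cut at its first blank, which meets the hypothesis of
    \<open>rewind\<close>.\<close>
  have "Blank \<notin> set (rev v)" by (auto simp: v dest: set_takeWhileD)
  from rewind[OF c2(1) this c2(3,2)]
  obtain ts'' u'' us'' where
    e3: "early (length v + 1) (num_states M1, ts' @ u' # us') (num_states M1 + 1, ts'' @ u'' # us'')"
    and c3: "length ts'' = num_tapes M1" "list_all2 tape_eq us'' ?blank" "tape_eq u'' ([], v)"
    by auto
  have "early (?T + ((length v + 1) + (length v + 1))) (init_config C w)
      (num_states M1 + 1, ts'' @ u'' # us'')"
    using early_trans[OF _ early_trans[OF e2 e3]] e1 by (simp add: us1(1) ts)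
  moreover have "(length v + 1) + (length v + 1) = 2 * length v + 2" by simp
  moreover have "list_all2 tape_eq (u'' # us'') (snd (init_config M2 v))"
    using c3 by (simp add: init_config_def)
  ultimately show ?thesis
    using c3(1) by metis
qed

section \<open>The composite run as a delayed run of the second machine\<close>

context
  fixes w v :: "sym list" and S :: nat
  assumes halts1: "halts {} M1 w"
  defines "v \<equiv> output_word {} M1 w"
  defines "S \<equiv> runtime {} M1 w + (2 * length v + 2)"
begin

lemma state_before_transfer: "i < S \<Longrightarrow> fst (config_at orc C w i) \<le> num_states M1"
  using transfer[OF halts1] by (auto simp: early_def config_at_def S_def v_def)

lemma simulate_second:
  "\<exists>ts us. config_at orc C w (S + n) =
      (num_states M1 + 1 + fst (config_at orc M2 v n), ts @ us) \<and>
      length ts = num_tapes M1 \<and> list_all2 tape_eq us (snd (config_at orc M2 v n))"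
proof (induction n)
  case 0
  obtain ts u us where "early S (init_config C w) (num_states M1 + 1, ts @ u # us)"
    "length ts = num_tapes M1" "list_all2 tape_eq (u # us) (snd (init_config M2 v))"
    using transfer[OF halts1] unfolding S_def v_def by blast
  then show ?case
    by (intro exI[of _ ts] exI[of _ "u # us"])
      (simp add: early_def config_at_def init_config_def[of M2])
next
  case (Suc n)
  then obtain ts us where "config_at orc C w (S + n) =
      (num_states M1 + 1 + fst (config_at orc M2 v n), ts @ us)"
      "length ts = num_tapes M1" "list_all2 tape_eq us (snd (config_at orc M2 v n))"
    by blast
  then show ?case
    using simulate_second_step[OF wf_config_at[OF wf2]] by simp
qed

lemma fst_second:
  "fst (config_at orc C w (S + n)) = num_states M1 + 1 + fst (config_at orc M2 v n)"
  using simulate_second[of n] by auto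

lemma halted_second: "halted C (config_at orc C w (S + n)) \<longleftrightarrow> halted M2 (config_at orc M2 v n)"
  by (simp add: halted_def fst_second)

lemma querying_second:
  "querying C (config_at orc C w (S + n)) \<longleftrightarrow> querying M2 (config_at orc M2 v n)"
  using simulate_second[of n] querying_seq_iff by (metis prod.collapse)

lemma last_word_second: "last_word (config_at orc C w (S + n)) = last_word (config_at orc M2 v n)"
proof -
  let ?c = "config_at orc M2 v n"
  obtain ts us where us: "config_at orc C w (S + n) = (num_states M1 + 1 + fst ?c, ts @ us)"
      "list_all2 tape_eq us (snd ?c)"
    using simulate_second by blast
  have "snd ?c \<noteq> []"
    using wf_config_at[OF wf2, of orc v n] wf2 by (auto simp: wf_config_def wf_machine_def)
  moreover have "length us = length (snd ?c)"
    using us(2) by (rule list_all2_lengthD)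
  ultimately have "us \<noteq> []" by auto
  then show ?thesis
    using last_word_tape_eq[OF us(2)] by (metis us(1) prod.collapse)
qed

text \<open>Before time \<open>S\<close> the composite cannot halt, and from \<open>S\<close> on it
  halts exactly when \<open>M2\<close> does.\<close>

lemma runtime_seq:
  assumes "halts orc M2 v"
  shows "runtime orc C w = S + runtime orc M2 v"
  unfolding runtime_def[of orc C w]
proof (rule Least_equality)
  show "halted C (config_at orc C w (S + runtime orc M2 v))"
    using halted_runtime[OF assms] by (simp add: halted_second)
next
  fix i assume i: "halted C (config_at orc C w i)"
  then have "S \<le> i"
    using state_before_transfer[of i] not_halted_seq by (meson not_le)
  then obtain n where n: "i = S + n" using le_iff_add by auto
  then have "runtime orc M2 v \<le> n"
    using i not_halted_before_runtime[of n orc M2 v] by (meson halted_second not_le)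
  then show "S + runtime orc M2 v \<le> i" by (simp add: n)
qed

lemma halts_seq: "halts orc M2 v \<Longrightarrow> halts orc C w"
  unfolding halts_def using halted_second by blast

lemma accepts_seq: "halts orc M2 v \<Longrightarrow> accepts orc C w \<longleftrightarrow> accepts orc M2 v"
  by (simp add: accepts_def runtime_seq fst_second)

text \<open>Steps before \<open>S\<close> contribute nothing; later ones match those of
  \<open>M2\<close> in both the query test and the word. Equality as lists preserves the number and
  the total size of the queries.\<close>

lemma queries_seq:
  assumes "halts orc M2 v"
  shows "queries orc C w = queries orc M2 v"
proof -
  have "[0..<runtime orc C w] = [0..<S] @ map (\<lambda>i. S + i) [0..<runtime orc M2 v]"
    using map_add_upt[of S "runtime orc M2 v"] upt_add_eq_append[of 0 S "runtime orc M2 v"]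
    by (simp add: runtime_seq[OF assms] add.commute)
  moreover have "filter (\<lambda>i. querying C (config_at orc C w i)) [0..<S] = []"
    using state_before_transfer not_querying_seq by (auto simp: filter_empty_conv)
  ultimately show ?thesis
    by (simp add: queries_def filter_map o_def querying_second last_word_second)
qed

end

end

section \<open>Growth estimates\<close>

text \<open>The two variables, later log t and the maximal length, get separate powers: the first is
  to be absorbed by a power of t, the second to remain as a polynomial.\<close>

definition poly_bounded2 :: "(real \<Rightarrow> real \<Rightarrow> real) \<Rightarrow> bool" where
  "poly_bounded2 h \<longleftrightarrow>
     (\<exists>c\<ge>0. \<exists>j k. \<forall>x\<ge>0. \<forall>y\<ge>0. \<bar>h x y\<bar> \<le> c * (1 + x) ^ j * (1 + y) ^ k)"

lemma poly_bounded2I: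
  assumes "0 \<le> c" "\<And>x y. 0 \<le> x \<Longrightarrow> 0 \<le> y \<Longrightarrow> \<bar>h x y\<bar> \<le> c * (1 + x) ^ j * (1 + y) ^ k"
  shows "poly_bounded2 h"
  unfolding poly_bounded2_def using assms by blast

lemma poly_bounded2_const: "poly_bounded2 (\<lambda>x y. c)"
  by (rule poly_bounded2I[of "\<bar>c\<bar>" _ 0 0]) auto

lemma poly_bounded2_fst: "poly_bounded2 (\<lambda>x y. x)"
  by (rule poly_bounded2I[of 1 _ 1 0]) auto

lemma poly_bounded2_snd: "poly_bounded2 (\<lambda>x y. y)"
  by (rule poly_bounded2I[of 1 _ 0 1]) auto

lemma poly_bounded2_abs: "poly_bounded2 h \<Longrightarrow> poly_bounded2 (\<lambda>x y. \<bar>h x y\<bar>)"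
  by (simp add: poly_bounded2_def)

lemma poly_bounded2_add:
  assumes "poly_bounded2 h" "poly_bounded2 h'"
  shows "poly_bounded2 (\<lambda>x y. h x y + h' x y)"
proof -
  obtain c j k where h: "0 \<le> c"
    "\<And>x y. 0 \<le> x \<Longrightarrow> 0 \<le> y \<Longrightarrow> \<bar>h x y\<bar> \<le> c * (1 + x) ^ j * (1 + y) ^ k"
    using assms(1) unfolding poly_bounded2_def by blast
  obtain c' j' k' where h': "0 \<le> c'"
    "\<And>x y. 0 \<le> x \<Longrightarrow> 0 \<le> y \<Longrightarrow> \<bar>h' x y\<bar> \<le> c' * (1 + x) ^ j' * (1 + y) ^ k'"
    using assms(2) unfolding poly_bounded2_def by blast
  show ?thesis
  \<comment> \<open>The summed exponents dominate both summands, all bases being at least 1.\<close>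
  proof (rule poly_bounded2I[of "c + c'" _ "j + j'" "k + k'"])
    fix x y :: real assume xy: "0 \<le> x" "0 \<le> y"
    have "c * (1 + x) ^ j * (1 + y) ^ k \<le> c * (1 + x) ^ (j + j') * (1 + y) ^ (k + k')"
      using xy h(1) by (intro mult_mono power_increasing) auto
    moreover have "c' * (1 + x) ^ j' * (1 + y) ^ k' \<le> c' * (1 + x) ^ (j + j') * (1 + y) ^ (k + k')"
      using xy h'(1) by (intro mult_mono power_increasing) auto
    ultimately show "\<bar>h x y + h' x y\<bar> \<le> (c + c') * (1 + x) ^ (j + j') * (1 + y) ^ (k + k')"
      using h(2)[OF xy] h'(2)[OF xy] by (simp add: algebra_simps)
  qed (use h h' in auto)
qed

lemma poly_bounded2_mult:
  assumes "poly_bounded2 h" "poly_bounded2 h'"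
  shows "poly_bounded2 (\<lambda>x y. h x y * h' x y)"
proof -
  obtain c j k where h: "0 \<le> c"
    "\<And>x y. 0 \<le> x \<Longrightarrow> 0 \<le> y \<Longrightarrow> \<bar>h x y\<bar> \<le> c * (1 + x) ^ j * (1 + y) ^ k"
    using assms(1) unfolding poly_bounded2_def by blast
  obtain c' j' k' where h': "0 \<le> c'"
    "\<And>x y. 0 \<le> x \<Longrightarrow> 0 \<le> y \<Longrightarrow> \<bar>h' x y\<bar> \<le> c' * (1 + x) ^ j' * (1 + y) ^ k'"
    using assms(2) unfolding poly_bounded2_def by blast
  show ?thesis
  proof (rule poly_bounded2I[of "c * c'" _ "j + j'" "k + k'"])
    fix x y :: real assume xy: "0 \<le> x" "0 \<le> y"
    have "\<bar>h x y\<bar> * \<bar>h' x y\<bar> \<le>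
        (c * (1 + x) ^ j * (1 + y) ^ k) * (c' * (1 + x) ^ j' * (1 + y) ^ k')"
      using h h' xy by (intro mult_mono) auto
    then show "\<bar>h x y * h' x y\<bar> \<le> c * c' * (1 + x) ^ (j + j') * (1 + y) ^ (k + k')"
      by (simp add: abs_mult power_add mult_ac)
  qed (use h h' in auto)
qed

text \<open>Induction along the Horner form; thereby mixed arguments such as the sum of both
  variables separate too.\<close>

lemma poly_bounded2_poly: "poly_bounded2 h \<Longrightarrow> poly_bounded2 (\<lambda>x y. poly p (h x y))"
  by (induction p) (auto intro: poly_bounded2_const poly_bounded2_add poly_bounded2_mult)

lemmas poly_bounded2_intros = poly_bounded2_const poly_bounded2_fst poly_bounded2_snd
  poly_bounded2_abs poly_bounded2_add poly_bounded2_mult poly_bounded2_poly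

section \<open>Polynomials over the naturals, logarithms and powers\<close>

lemma nat_poly_mono:
  fixes p :: "nat poly"
  assumes "x \<le> y"
  shows "poly p x \<le> poly p y"
  using assms by (induction p) (auto intro: add_mono mult_mono)

text \<open>Natural coefficients make the polynomial monotone, so a real upper bound on the argument
  suffices; \<open>f'\<close> is \<open>f\<close> with its coefficients read as reals.\<close>

lemma nat_poly_le_real_poly:
  fixes f :: "nat poly"
  shows "\<exists>f' :: real poly. \<forall>n x. real n \<le> x \<longrightarrow> real (poly f n) \<le> poly f' x"
proof (induction f)
  case 0
  then show ?case by (intro exI[of _ 0]) simp
next
  case (pCons c f)
  then obtain f' :: "real poly" where f': "\<And>n x. real n \<le> x \<Longrightarrow> real (poly f n) \<le> poly f' x"
    by blast
  have "real n * real (poly f n) \<le> x * poly f' x" if "real n \<le> x" for n x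
    using that f'[OF that] by (intro mult_mono) auto
  then show ?case
    by (intro exI[of _ "pCons (real c) f'"]) simp
qed

lemma log_power_le_powr:
  assumes "0 < \<delta>"
  shows "\<exists>c\<ge>0. \<forall>t\<ge>1. (1 + log 2 t) ^ k \<le> c * t powr \<delta>"
proof -
  \<comment> \<open>The \<open>k\<close>-th power of \<open>t powr a\<close> must stay below
    \<open>t powr \<delta>\<close>; the added 1 keeps the denominator positive for
    \<open>k = 0\<close>.\<close>
  define a where "a = \<delta> / (real k + 1)"
  have a: "0 < a" "a * real k \<le> \<delta>"
    using assms by (auto simp: a_def field_simps)
  \<comment> \<open>The 1 pays for the constant summand, as \<open>1 \<le> t powr a\<close>; the
    fraction comes from \<open>ln t \<le> t powr a / a\<close>.\<close>
  let ?K = "1 + 1 / (a * ln 2)"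
  have "(1 + log 2 t) ^ k \<le> ?K ^ k * t powr \<delta>" if t: "1 \<le> t" for t :: real
  proof -
    have "ln t / ln 2 \<le> (t powr a / a) / ln 2"
      using ln_powr_bound[OF t a(1)] by (intro divide_right_mono) auto
    moreover have "1 \<le> t powr a" using t a by (simp add: ge_one_powr_ge_zero)
    ultimately have "1 + log 2 t \<le> ?K * t powr a"
      by (simp add: log_def algebra_simps)
    then have "(1 + log 2 t) ^ k \<le> (?K * t powr a) ^ k"
      using t by (intro power_mono) auto
    also have "\<dots> = ?K ^ k * t powr (a * real k)"
      using t by (simp add: power_mult_distrib powr_powr[symmetric] powr_realpow)
    also have "\<dots> \<le> ?K ^ k * t powr \<delta>"
      using t a by (intro mult_left_mono powr_mono) auto
    finally show ?thesis .
  qed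
  then show ?thesis
    using a by (intro exI[of _ "?K ^ k"]) auto
qed

lemma powr_le_one_plus:
  fixes x s :: real
  assumes "0 \<le> x" "0 \<le> s" "s \<le> 1"
  shows "x powr s \<le> 1 + x"
proof (cases "x \<le> 1")
  case True
  then show ?thesis using assms powr_le1[of s x] by simp
next
  case False
  then show ?thesis using assms powr_mono[of s 1 x] by simp
qed

text \<open>The asymptotic bound holds from some \<open>N\<close> on, and the finitely many values
  below go into the constant. The summand 1 covers \<open>n = 0\<close>, where the power is
  0.\<close>

lemma sublinear_bound:
  fixes g :: "nat \<Rightarrow> nat"
  assumes "(\<lambda>n. real (g n)) \<in> O(\<lambda>n. real n powr (1 - \<epsilon>))" "e \<le> \<epsilon>"
  shows "\<exists>G\<ge>0. \<forall>n. real (g n) \<le> G * (1 + real n powr (1 - e))"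
proof -
  obtain c where c: "0 < c"
    "eventually (\<lambda>n. norm (real (g n)) \<le> c * norm (real n powr (1 - \<epsilon>))) at_top"
    using landau_o.bigE[OF assms(1)] by blast
  then obtain N where N: "\<And>n. N \<le> n \<Longrightarrow> real (g n) \<le> c * real n powr (1 - \<epsilon>)"
    by (auto simp: eventually_at_top_linorder)
  define G where "G = c + (\<Sum>i\<le>N. real (g i))"
  have "0 \<le> G" using c(1) unfolding G_def by (intro add_nonneg_nonneg sum_nonneg) auto
  have "real (g n) \<le> G * (1 + real n powr (1 - e))" for n
  proof (cases "n \<le> N")
    case True
    then have "real (g n) \<le> (\<Sum>i\<le>N. real (g i))"
      by (intro member_le_sum) auto
    also have "\<dots> \<le> G * 1" using c(1) by (simp add: G_def)
    also have "\<dots> \<le> G * (1 + real n powr (1 - e))"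
      using \<open>0 \<le> G\<close> by (intro mult_left_mono) auto
    finally show ?thesis .
  next
    case False
    then have "real (g n) \<le> c * real n powr (1 - \<epsilon>)" using N by simp
    also have "\<dots> \<le> c * (1 + real n powr (1 - e))"
      using c(1) False assms(2) powr_mono[of "1 - \<epsilon>" "1 - e" "real n"]
      by (intro mult_left_mono) auto
    also have "\<dots> \<le> G * (1 + real n powr (1 - e))"
      by (intro mult_right_mono) (auto simp: G_def intro: sum_nonneg)
    finally show ?thesis .
  qed
  then show ?thesis using \<open>0 \<le> G\<close> by blast
qed

text \<open>Here \<open>n\<close> is the size of the composed instance, \<open>p\<close> its
  parameter and \<open>m\<close> the maximal input length. The number of queries costs
  \<open>t powr (1 - e)\<close>, the logarithms cost \<open>t powr (e / 2)\<close>, and \<delta> is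
  the remaining \<open>e / 2\<close>.\<close>

lemma total_query_size_bound:
  fixes a b d :: "real poly" and f :: "nat poly" and g :: "nat \<Rightarrow> nat" and \<epsilon> :: real
  assumes "0 < \<epsilon>" and g: "(\<lambda>n. real (g n)) \<in> O(\<lambda>n. real n powr (1 - \<epsilon>))"
  shows "\<exists>\<delta>>0. \<exists>B :: real poly. \<forall>t n p m :: nat. 1 \<le> t \<longrightarrow>
     real n \<le> real t * poly a (log 2 (real t)) * poly b (real m) \<longrightarrow>
     real p \<le> poly d (real m + log 2 (real t)) \<longrightarrow>
     real (g n * (poly f p + c0)) \<le> real t powr (1 - \<delta>) * poly B (real m)"
proof -
  \<comment> \<open>The cap at 1/2 keeps \<open>1 - e\<close> between 0 and 1, as monotonicity of
    the power and \<open>powr_le_one_plus\<close> require.\<close>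
  define e where "e = min \<epsilon> (1 / 2)"
  have e: "0 < e" "e \<le> \<epsilon>" "e \<le> 1 / 2" using assms(1) by (auto simp: e_def)
  obtain G where G: "0 \<le> G" "\<And>n. real (g n) \<le> G * (1 + real n powr (1 - e))"
    using sublinear_bound[OF g e(2)] by blast
  obtain f' :: "real poly" where f': "\<And>n x. real n \<le> x \<Longrightarrow> real (poly f n) \<le> poly f' x"
    using nat_poly_le_real_poly by blast
  \<comment> \<open>What remains once \<open>t powr (1 - e)\<close> is taken out. The 2 collects the
    ones of \<open>sublinear_bound\<close> and \<open>powr_le_one_plus\<close>; absolute values
    guard against negative coefficients.\<close>
  define H where "H = (\<lambda>l m. G * (2 + \<bar>poly a l\<bar> * \<bar>poly b m\<bar>) * (poly f' \<bar>poly d (m + l)\<bar> + real c0))"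
  have "poly_bounded2 H"
    unfolding H_def by (intro poly_bounded2_intros)
  then obtain c j k where H: "0 \<le> c"
    "\<And>l m. 0 \<le> l \<Longrightarrow> 0 \<le> m \<Longrightarrow> \<bar>H l m\<bar> \<le> c * (1 + l) ^ j * (1 + m) ^ k"
    unfolding poly_bounded2_def by blast
  have "0 < e / 2" using e(1) by simp
  from log_power_le_powr[OF this, of j] obtain K where
    K: "0 \<le> K" "\<And>t. 1 \<le> t \<Longrightarrow> (1 + log 2 t) ^ j \<le> K * t powr (e / 2)" by blast
  \<comment> \<open>This is \<open>c * K * (1 + X) ^ k\<close>, what is left of the bound on
    \<open>H\<close> after its logarithmic factor is traded for
    \<open>K * t powr (e / 2)\<close>.\<close>
  define B where "B = smult (c * K) ([:1, 1:] ^ k)"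
  have "real (g n * (poly f p + c0)) \<le> real t powr (1 - e / 2) * poly B (real m)"
    if t: "1 \<le> t" and n: "real n \<le> real t * poly a (log 2 (real t)) * poly b (real m)"
      and p: "real p \<le> poly d (real m + log 2 (real t))" for t n p m :: nat
  proof -
    define l where "l = log 2 (real t)"
    have l: "0 \<le> l" using t by (simp add: l_def)
    define AB where "AB = \<bar>poly a l\<bar> * \<bar>poly b (real m)\<bar>"
    have AB: "0 \<le> AB" by (simp add: AB_def)
    have "poly a l * poly b (real m) \<le> AB"
      unfolding AB_def by (metis abs_ge_self abs_mult)
    then have "real t * (poly a l * poly b (real m)) \<le> real t * AB"
      by (intro mult_left_mono) auto
    then have "real n \<le> real t * AB"
      using n by (simp add: l_def mult.assoc)
    then have "real n powr (1 - e) \<le> (real t * AB) powr (1 - e)"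
      using e by (intro powr_mono2) auto
    also have "\<dots> = real t powr (1 - e) * AB powr (1 - e)"
      using AB by (simp add: powr_mult)
    also have "\<dots> \<le> real t powr (1 - e) * (1 + AB)"
      using AB e by (intro mult_left_mono powr_le_one_plus) auto
    \<comment> \<open>The leading 1 is at most \<open>t powr (1 - e)\<close>, because
      \<open>1 \<le> t\<close>.\<close>
    finally have "1 + real n powr (1 - e) \<le> real t powr (1 - e) * (2 + AB)"
      using t e ge_one_powr_ge_zero[of "real t" "1 - e"] by (simp add: algebra_simps)
    then have "G * (1 + real n powr (1 - e)) \<le> G * (real t powr (1 - e) * (2 + AB))"
      using G(1) by (rule mult_left_mono)
    then have gn: "real (g n) \<le> real t powr (1 - e) * (G * (2 + AB))"
      using G(2)[of n] by (simp add: mult_ac)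
    have "real p \<le> \<bar>poly d (real m + l)\<bar>" using p by (simp add: l_def)
    from f'[OF this] have "real (poly f p + c0) \<le> poly f' \<bar>poly d (real m + l)\<bar> + real c0" by simp
    with gn have "real (g n) * real (poly f p + c0) \<le>
        (real t powr (1 - e) * (G * (2 + AB))) * (poly f' \<bar>poly d (real m + l)\<bar> + real c0)"
      using G(1) AB by (intro mult_mono) auto
    also have "\<dots> = real t powr (1 - e) * H l (real m)"
      by (simp add: H_def AB_def mult_ac)
    also have "\<dots> \<le> real t powr (1 - e) * (c * (1 + l) ^ j * (1 + real m) ^ k)"
      using H(2)[OF l, of "real m"] by (intro mult_left_mono) auto
    also have "\<dots> \<le> real t powr (1 - e) * (c * (K * real t powr (e / 2)) * (1 + real m) ^ k)"
      using K(2)[of "real t"] t H(1) unfolding l_def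
      by (intro mult_left_mono mult_right_mono) auto
    also have "\<dots> = (real t powr (1 - e) * real t powr (e / 2)) * (c * K * (1 + real m) ^ k)"
      by (simp add: mult_ac)
    also have "real t powr (1 - e) * real t powr (e / 2) = real t powr (1 - e / 2)"
      by (simp add: powr_add[symmetric])
    finally show ?thesis by (simp add: B_def poly_power)
  qed
  then show ?thesis
    using e(1) by (intro exI[of _ "e / 2"] conjI exI[of _ B] allI impI) auto
qed

section \<open>Composition followed by kernel as a distillation\<close>

theorem theorem8:
  fixes c0 :: nat and L :: classical_problem and R :: param_problem
  assumes "NP_hard L"
    and "linear_OR_composition c0 L R"
    and "\<exists>\<epsilon> > 0. \<exists>M g. poly_turing_kernel c0 M R \<and> query_bound c0 M R g \<and>
           (\<lambda>n. real (g n)) \<in> O(\<lambda>n. real n powr (1 - \<epsilon>))"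
  shows "\<exists>A. oracle_OR_distillation c0 A L R"
proof -
  obtain M1 r1 and a b d :: "real poly" where plain: "plain_machine M1"
    and halts1: "\<And>xs. xs \<noteq> [] \<Longrightarrow>
      halts_within {} M1 (enc_list xs) (poly r1 (length (enc_list xs)))"
    and out: "\<And>xs. xs \<noteq> [] \<Longrightarrow> \<exists>y p. output_word {} M1 (enc_list xs) = enc_inst (y, p) \<and>
        real (psize c0 (y, p)) \<le>
          real (length xs) * poly a (log 2 (real (length xs))) * poly b (real (max_len xs)) \<and>
        real p \<le> poly d (real (max_len xs) + log 2 (real (length xs))) \<and>
        ((y, p) \<in> R \<longleftrightarrow> (\<exists>x \<in> set xs. x \<in> L))"
    using assms(2) unfolding linear_OR_composition_def by blast
  obtain \<epsilon> M2 g f where "0 < \<epsilon>" and kernel: "turing_kernel c0 M2 R (poly f)"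
    and qb: "query_bound c0 M2 R g" and g: "(\<lambda>n. real (g n)) \<in> O(\<lambda>n. real n powr (1 - \<epsilon>))"
    using assms(3) unfolding poly_turing_kernel_def by blast
  let ?O = "oracle_of R"
  obtain r2 where wf: "wf_machine M2"
    and halts2: "\<And>x p. halts_within ?O M2 (enc_inst (x, p)) (poly r2 (psize c0 (x, p)))"
    and correct: "\<And>x p. accepts ?O M2 (enc_inst (x, p)) \<longleftrightarrow> (x, p) \<in> R"
    and small: "\<And>x p w. w \<in> set (queries ?O M2 (enc_inst (x, p))) \<Longrightarrow>
        \<exists>y p'. w = enc_inst (y, p') \<and> length y + p' \<le> poly f p"
    using kernel unfolding turing_kernel_def by blast
  obtain \<delta> and B :: "real poly" where "0 < \<delta>" and bound: "\<And>t n p m :: nat. 1 \<le> t \<Longrightarrow>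
     real n \<le> real t * poly a (log 2 (real t)) * poly b (real m) \<Longrightarrow>
     real p \<le> poly d (real m + log 2 (real t)) \<Longrightarrow>
     real (g n * (poly f p + c0)) \<le> real t powr (1 - \<delta>) * poly B (real m)"
    using total_query_size_bound[OF \<open>0 < \<epsilon>\<close> g, of a b d f c0] by blast
  interpret seq M1 M2 ?O
    using plain wf by unfold_locales
  \<comment> \<open>Three phases on an encoding of length n: the composition, the handover of a word
    of length at most 1 + n + r1(n), and the kernel on an instance of size at most c0 + n +
    r1(n).\<close>
  define r where "r = r1 + (2 * ([:1, 1:] + r1) + 2) + pcompose r2 ([:c0, 1:] + r1)"
  have main: "halts_within ?O C (enc_list xs) (poly r (length (enc_list xs))) \<and>
      (\<exists>ys. queries ?O C (enc_list xs) = map enc_inst ys \<and>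
         real (\<Sum>y\<leftarrow>ys. psize c0 y)
           \<le> real (length xs) powr (1 - \<delta>) * poly B (real (max_len xs))) \<and>
      (accepts ?O C (enc_list xs) \<longleftrightarrow> (\<exists>x \<in> set xs. x \<in> L))"
    if xs: "xs \<noteq> []" for xs
  proof -
    let ?w = "enc_list xs"
    obtain y p where v: "output_word {} M1 ?w = enc_inst (y, p)"
      and n: "real (psize c0 (y, p)) \<le>
          real (length xs) * poly a (log 2 (real (length xs))) * poly b (real (max_len xs))"
      and p: "real p \<le> poly d (real (max_len xs) + log 2 (real (length xs)))"
      and R: "(y, p) \<in> R \<longleftrightarrow> (\<exists>x \<in> set xs. x \<in> L)"
      using out[OF xs] by blast
    let ?v = "enc_inst (y, p)"
    have h1: "halts {} M1 ?w" and T1: "runtime {} M1 ?w \<le> poly r1 (length ?w)"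
      using halts1[OF xs] by (auto simp: halts_within_def)
    have h2: "halts ?O M2 ?v" and T2: "runtime ?O M2 ?v \<le> poly r2 (psize c0 (y, p))"
      using halts2[of y p] by (auto simp: halts_within_def)
    have len: "length ?v \<le> length ?w + 1 + poly r1 (length ?w)"
      using length_output_word[OF wf1, of "{}" ?w] T1 v by simp
    \<comment> \<open>The separator \<open>Hash\<close> in the encoding uses up the 1 of the output
      bound.\<close>
    then have "psize c0 (y, p) \<le> c0 + length ?w + poly r1 (length ?w)"
      by (simp add: psize_def enc_inst_def enc_bits_def)
    then have "runtime ?O M2 ?v \<le> poly r2 (c0 + length ?w + poly r1 (length ?w))"
      using T2 nat_poly_mono order_trans by blast
    then have "runtime ?O C ?w \<le> poly r (length ?w)"
      using runtime_seq[OF h1, unfolded v, OF h2] T1 len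
      by (simp add: r_def poly_pcompose)
    moreover have "halts ?O C ?w"
      using halts_seq[OF h1, unfolded v, OF h2] .
    moreover have "accepts ?O C ?w \<longleftrightarrow> (\<exists>x \<in> set xs. x \<in> L)"
      using accepts_seq[OF h1, unfolded v, OF h2] correct R by simp
    moreover
    let ?qs = "queries ?O M2 ?v"
    have qs: "queries ?O C ?w = ?qs"
      using queries_seq[OF h1, unfolded v, OF h2] .
    \<comment> \<open>The kernel bounds \<open>length y + p'\<close>; \<open>psize\<close> adds
      \<open>c0\<close>.\<close>
    have "\<exists>y. q = enc_inst y \<and> psize c0 y \<le> poly f p + c0" if "q \<in> set ?qs" for q
      using small[OF that] by (fastforce simp: psize_def)
    \<comment> \<open>\<open>h\<close> chooses the encoded instance for every query word, so that
      the query list becomes an image under \<open>enc_inst\<close>.\<close>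
    then obtain h where h: "\<And>q. q \<in> set ?qs \<Longrightarrow> q = enc_inst (h q) \<and> psize c0 (h q) \<le> poly f p + c0"
      by metis
    have "map enc_inst (map h ?qs) = ?qs"
      using h by (simp add: map_idI)
    moreover have "(\<Sum>y\<leftarrow>map h ?qs. psize c0 y) \<le> length ?qs * (poly f p + c0)"
      using h sum_list_mono[of ?qs "psize c0 \<circ> h" "\<lambda>_. poly f p + c0"]
      by (simp add: sum_list_triv o_def)
    \<comment> \<open>\<open>g\<close> is taken at the size of the composed instance, the input of
      the kernel.\<close>
    then have "(\<Sum>y\<leftarrow>map h ?qs. psize c0 y) \<le> g (psize c0 (y, p)) * (poly f p + c0)"
      using qb mult_le_mono1 order_trans unfolding query_bound_def by blast
    then have "real (\<Sum>y\<leftarrow>map h ?qs. psize c0 y)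
           \<le> real (g (psize c0 (y, p)) * (poly f p + c0))"
      by (rule of_nat_mono)
    then have "real (\<Sum>y\<leftarrow>map h ?qs. psize c0 y)
           \<le> real (length xs) powr (1 - \<delta>) * poly B (real (max_len xs))"
      using bound[OF _ n p] xs by (meson length_0_conv less_one not_le order_trans)
    ultimately show ?thesis
      unfolding halts_within_def qs by metis
  qed
  show ?thesis
    unfolding oracle_OR_distillation_def
    using wf_seq_machine[OF plain wf] main \<open>0 < \<delta>\<close> by blast
qed

end
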